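(* Let $n\ge 3$. There exist LNE complex algebraic curves of $\mathbb{C}^n$ which are not (outer) Lipschitz equivalent to any complex algebraic curve of $\mathbb{C}^2$. In particular, there are LNE complex algebraic curves of $\mathbb{C}^n$ which are not (outer) Lipschitz equivalent to any of their plane projections, that is, to any of their images by linear projections $\mathbb{C}^n\to\mathbb{C}^2$.
   Context: A complex algebraic curve of $\mathbb{C}^n$ is a (closed) algebraic subset of complex dimension $1$ at each of its points. For $S\subset\mathbb{C}^n$, the outer distance on $S$ is $d_S(\mathbf{s},\mathbf{s}')=|\mathbf{s}-\mathbf{s}'|$, and the inner distance $d_{\rm inn}^S(\mathbf{s},\mathbf{s}')\in[0,+\infty]$ is the infimum of the lengths of rectifiable paths contained in $S$ joining $\mathbf{s}$ to $\mathbf{s}'$ ($+\infty$ if there is none). $S$ is Lipschitz normally embedded (LNE) if there is a constant $L>0$ such that $d_{\rm inn}^S\le L\,d_S$ on $S\times S$. Two sets $S_1\subset\mathbb{C}^{n_1}$, $S_2\subset\mathbb{C}^{n_2}$ are outer Lipschitz equivalent if there is a bi-Lipschitz homeomorphism $(S_1,d_{S_1})\to(S_2,d_{S_2})$. *)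

theory Defs
  imports "HOL-Analysis.Analysis"
begin

section \<open>Algebraic subsets of complex affine space\<close>

text \<open>The complex analogue of \<^const>\<open>real_polynomial_function\<close>: the algebra of functions on
  \<open>\<complex>\<^sup>n\<close> generated by the constants and the coordinates.\<close>

inductive complex_polynomial_function :: "(complex ^ 'n \<Rightarrow> complex) \<Rightarrow> bool" where
  const: "complex_polynomial_function (\<lambda>x. c)"
| coord: "complex_polynomial_function (\<lambda>x. x $ i)"
| add: "\<lbrakk>complex_polynomial_function f; complex_polynomial_function g\<rbrakk>
    \<Longrightarrow> complex_polynomial_function (\<lambda>x. f x + g x)"
| mult: "\<lbrakk>complex_polynomial_function f; complex_polynomial_function g\<rbrakk>
    \<Longrightarrow> complex_polynomial_function (\<lambda>x. f x * g x)"

definition algebraic_set :: "(complex ^ 'n) set \<Rightarrow> bool" where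
  "algebraic_set X \<longleftrightarrow>
    (\<exists>F. finite F \<and> (\<forall>f\<in>F. complex_polynomial_function f) \<and> X = {x. \<forall>f\<in>F. f x = 0})"

definition irreducible_algebraic_set :: "(complex ^ 'n) set \<Rightarrow> bool" where
  "irreducible_algebraic_set X \<longleftrightarrow>
    algebraic_set X \<and> X \<noteq> {} \<and>
    (\<forall>Y Z. algebraic_set Y \<and> algebraic_set Z \<and> X = Y \<union> Z \<longrightarrow> Y = X \<or> Z = X)"

text \<open>The local (Krull) dimension of \<open>X\<close> at \<open>x\<close>: the supremum of the lengths \<open>d\<close> of chains
  \<open>Z\<^sub>0 \<subset> Z\<^sub>1 \<subset> \<dots> \<subset> Z\<^sub>d \<subseteq> X\<close> of irreducible algebraic sets through \<open>x\<close>. Such chains correspond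
  to the chains of prime ideals of the local ring of \<open>X\<close> at \<open>x\<close>.\<close>

definition algebraic_dim_at :: "(complex ^ 'n) set \<Rightarrow> complex ^ 'n \<Rightarrow> enat" where
  "algebraic_dim_at X x =
    (SUP d \<in> {d. \<exists>Z. x \<in> Z 0 \<and> (\<forall>i\<le>d. irreducible_algebraic_set (Z i) \<and> Z i \<subseteq> X) \<and>
                     (\<forall>i<d. Z i \<subset> Z (Suc i))}. enat d)"

definition algebraic_curve :: "(complex ^ 'n) set \<Rightarrow> bool" where
  "algebraic_curve C \<longleftrightarrow> algebraic_set C \<and> (\<forall>x\<in>C. algebraic_dim_at C x = 1)"


section \<open>Inner distance and Lipschitz geometry\<close>

definition path_length :: "(real \<Rightarrow> 'a::metric_space) \<Rightarrow> ennreal" where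
  "path_length g =
    (SUP (n, t) \<in> {(n :: nat, t :: nat \<Rightarrow> real). mono_on {..n} t \<and> t ` {..n} \<subseteq> {0..1}}.
       \<Sum>i<n. ennreal (dist (g (t i)) (g (t (Suc i)))))"

definition rectifiable_path :: "(real \<Rightarrow> 'a::metric_space) \<Rightarrow> bool" where
  "rectifiable_path g \<longleftrightarrow> path g \<and> path_length g < \<infinity>"

text \<open>The infimum over the empty set of paths is \<open>\<infinity>\<close>.\<close>

definition inner_dist :: "'a::metric_space set \<Rightarrow> 'a \<Rightarrow> 'a \<Rightarrow> ennreal" where
  "inner_dist S x y =
    (INF g \<in> {g. rectifiable_path g \<and> path_image g \<subseteq> S \<and> pathstart g = x \<and> pathfinish g = y}.
       path_length g)"

definition lipschitz_normally_embedded :: "'a::metric_space set \<Rightarrow> bool" where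
  "lipschitz_normally_embedded S \<longleftrightarrow>
    (\<exists>L>0. \<forall>x\<in>S. \<forall>y\<in>S. inner_dist S x y \<le> ennreal (L * dist x y))"

definition outer_lipschitz_equivalent ::
    "'a::metric_space set \<Rightarrow> 'b::metric_space set \<Rightarrow> bool" where
  "outer_lipschitz_equivalent S T \<longleftrightarrow>
    (\<exists>f g K L. homeomorphism S T f g \<and> K-lipschitz_on S f \<and> L-lipschitz_on T g)"

end

theory Submission
  imports Defs "HOL-Complex_Analysis.Great_Picard"
begin

text \<open>The curve is a chain of three lines: two skew lines with different directions and a third line that meets
  both. Lines that differ in direction separate linearly, so the chain is Lipschitz normally embedded
  (\<open>lipschitz_normally_embedded_three_line_chain\<close>), and it is an algebraic curve by
  \<open>algebraic_curve_Union_coordinate_lines\<close>.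

  In \<open>\<complex>\<^sup>2\<close> there is no room for such a configuration. Suppose that a bi-Lipschitz map sends the chain into the zero
  set of a nonzero polynomial \<open>p\<close> in two variables. Rescaling the images of the two skew lines towards infinity gives, in the limit,
  bi-Lipschitz maps into the zero set of the leading form of \<open>p\<close> (\<open>leading_form\<close>), which is a finite union of complex
  lines through the origin (\<open>form_vanishes_on_finitely_many_lines\<close>). By connectedness each of the two limits stays in one
  line (\<open>connected_in_finitely_many_lines\<close>), and the two lines are different because the limits meet in the origin only.
  Two different lines through the origin of \<open>\<complex>\<^sup>2\<close> cross transversally, and a transversal crossing survives small
  perturbations (\<open>zero_of_injective_map_persists\<close>, from invariance of domain and Brouwer's fixed point theorem).
  Hence the images of the two skew lines already intersect (\<open>asymptotic_planes_meet\<close>), although the lines are disjoint.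

  A plane algebraic set is either contained in such a zero set or is all of \<open>\<complex>\<^sup>2\<close>, and the latter is excluded by
  dimension. A linear projection of the chain to \<open>\<complex>\<^sup>2\<close> is contained in a union of three affine lines, hence in the zero
  set of a product of three affine functions. So one and the same curve proves both claims.\<close>

section \<open>Zero sets of polynomial functions near infinity\<close>

lemma complex_polynomial_function_sum:
  assumes "\<And>i. i \<in> I \<Longrightarrow> complex_polynomial_function (f i)"
  shows "complex_polynomial_function (\<lambda>x. \<Sum>i\<in>I. f i x)"
  using assms
  by (induction I rule: infinite_finite_induct)
    (auto intro: complex_polynomial_function.intros)

text \<open>Expanding \<open>p (a + t v)\<close> in powers of \<open>t\<close> serves as a substitute for multivariate polynomials: for
  \<open>a = 0\<close> the coefficients are the homogeneous components of \<open>p\<close>, evaluated at \<open>v\<close>. The uniform degree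
  bound is what makes a leading component exist.\<close>
lemma polynomial_along_lines:
  fixes a :: "complex ^ 'n"
  assumes "complex_polynomial_function p"
  obtains Q N where "\<And>v t. p (a + t *s v) = poly (Q v) t"
    and "\<And>v. degree (Q v) \<le> N"
    and "\<And>k. complex_polynomial_function (\<lambda>v. coeff (Q v) k)"
proof -
  have "\<exists>Q N. (\<forall>v t. p (a + t *s v) = poly (Q v) t) \<and> (\<forall>v. degree (Q v) \<le> N) \<and>
          (\<forall>k. complex_polynomial_function (\<lambda>v. coeff (Q v) k))"
    using assms
  proof induction
    case (const c)
    show ?case
      by (intro exI[of _ "\<lambda>v. [:c:]"] exI[of _ 0])
        (auto intro: complex_polynomial_function.const)
  next
    case (coord i)
    have "complex_polynomial_function (\<lambda>v. coeff [:a $ i, v $ i:] k)" for k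
      by (cases k; cases "k - 1")
        (auto simp: coeff_pCons intro: complex_polynomial_function.intros)
    then show ?case
      by (intro exI[of _ "\<lambda>v. [:a $ i, v $ i:]"] exI[of _ 1]) auto
  next
    case (add f g)
    then obtain Q N R M
      where Q: "\<forall>v t. f (a + t *s v) = poly (Q v) t" "\<forall>v. degree (Q v) \<le> N"
          "\<forall>k. complex_polynomial_function (\<lambda>v. coeff (Q v) k)"
        and R: "\<forall>v t. g (a + t *s v) = poly (R v) t" "\<forall>v. degree (R v) \<le> M"
          "\<forall>k. complex_polynomial_function (\<lambda>v. coeff (R v) k)"
      by blast
    have "degree (Q v + R v) \<le> max N M" for v
      using Q(2) R(2) by (meson degree_add_le max.coboundedI1 max.coboundedI2)
    then show ?case using Q R
      by (intro exI[of _ "\<lambda>v. Q v + R v"] exI[of _ "max N M"])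
        (auto intro: complex_polynomial_function.intros)
  next
    case (mult f g)
    then obtain Q N R M
      where Q: "\<forall>v t. f (a + t *s v) = poly (Q v) t" "\<forall>v. degree (Q v) \<le> N"
          "\<forall>k. complex_polynomial_function (\<lambda>v. coeff (Q v) k)"
        and R: "\<forall>v t. g (a + t *s v) = poly (R v) t" "\<forall>v. degree (R v) \<le> M"
          "\<forall>k. complex_polynomial_function (\<lambda>v. coeff (R v) k)"
      by blast
    have "degree (Q v * R v) \<le> N + M" for v
      using Q(2) R(2) by (meson add_mono degree_mult_le order_trans)
    then show ?case using Q R
      by (intro exI[of _ "\<lambda>v. Q v * R v"] exI[of _ "N + M"])
        (auto simp: coeff_mult intro!: complex_polynomial_function_sum
          complex_polynomial_function.intros)
  qed
  then show ?thesis using that by blast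
qed

lemma polynomial_on_line:
  fixes a v :: "complex ^ 'n"
  assumes "complex_polynomial_function p"
  obtains q where "\<And>t. p (a + t *s v) = poly q t"
  using polynomial_along_lines[OF assms] by metis

lemma continuous_on_complex_polynomial_function:
  "complex_polynomial_function p \<Longrightarrow> continuous_on S p"
  by (induction rule: complex_polynomial_function.induct) (auto intro!: continuous_intros)


text \<open>\<open>h\<close> is the top homogeneous component of \<open>p\<close>. Dividing \<open>p (t x) = 0\<close> by \<open>t\<^sup>d\<close> and letting \<open>t\<close> tend to
  infinity leaves \<open>h\<close> only, so every limit of rescaled zeros of \<open>p\<close> is a zero of \<open>h\<close>. In other words, the
  tangent cone at infinity of the zero set lies in the zero set of the leading form.\<close>
lemma leading_form:
  fixes p :: "complex ^ 'n \<Rightarrow> complex"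
  assumes p: "complex_polynomial_function p" and nz: "p x0 \<noteq> 0"
  obtains h d x1 where "complex_polynomial_function h" "h x1 \<noteq> 0"
    and "\<And>c x. h (c *s x) = c ^ d * h x"
    and "\<And>t x y. \<lbrakk>filterlim t at_infinity sequentially; x \<longlonglongrightarrow> y; \<And>n. p (t n *s x n) = 0\<rbrakk>
           \<Longrightarrow> h y = 0"
proof -
  obtain Q N where Q: "\<And>v t. p (t *s v) = poly (Q v) t"
    and N: "\<And>v. degree (Q v) \<le> N"
    and coeff: "\<And>k. complex_polynomial_function (\<lambda>v. coeff (Q v) k)"
    using polynomial_along_lines[OF p, of 0] by auto
  define K where "K = {k. \<exists>v. coeff (Q v) k \<noteq> 0}"
  have "K \<subseteq> {..N}"
    using N by (auto simp: K_def intro: order_trans[OF le_degree])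
  then have finK: "finite K"
    by (rule finite_subset) simp
  have "Q x0 \<noteq> 0"
    using nz Q[of 1 x0] by auto
  then have "degree (Q x0) \<in> K"
    unfolding K_def using leading_coeff_0_iff by blast
  then have "K \<noteq> {}"
    by blast
  define d where "d = Max K"
  have "d \<in> K"
    using finK \<open>K \<noteq> {}\<close> by (simp add: d_def)
  have above: "coeff (Q v) k = 0" if "k > d" for v k
  proof (rule ccontr)
    assume "coeff (Q v) k \<noteq> 0"
    then have "k \<in> K"
      unfolding K_def by blast
    then have "k \<le> d"
      using finK by (simp add: d_def)
    with that show False by simp
  qed
  have expand: "p (t *s v) = (\<Sum>k\<le>d. coeff (Q v) k * t ^ k)" for t v
  proof -
    have "poly (Q v) t = (\<Sum>k\<le>degree (Q v). coeff (Q v) k * t ^ k)"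
      by (rule poly_altdef)
    also have "\<dots> = (\<Sum>k\<le>d. coeff (Q v) k * t ^ k)"
      by (rule sum.mono_neutral_left) (use above in \<open>auto intro: degree_le coeff_eq_0\<close>)
    finally show ?thesis
      by (simp add: Q)
  qed
  define h where "h = (\<lambda>v. coeff (Q v) d)"
  have scale: "h (c *s x) = c ^ d * h x" for c x
  proof -
    have "poly (Q (c *s x)) t = poly (Q x \<circ>\<^sub>p [:0, c:]) t" for t
      using Q[of t "c *s x"] Q[of "t * c" x] by (simp add: poly_pcompose mult.commute)
    then have "Q (c *s x) = Q x \<circ>\<^sub>p [:0, c:]"
      by (auto simp: poly_eq_poly_eq_iff[symmetric])
    then show ?thesis
      by (simp add: h_def coeff_pcompose_linear)
  qed
  have limit: "h y = 0"
    if t: "filterlim t at_infinity sequentially" and x: "x \<longlonglongrightarrow> y"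
      and zero: "\<And>n. p (t n *s x n) = 0" for t x y
  proof -
    have inv: "(\<lambda>n. inverse (t n)) \<longlonglongrightarrow> 0"
      by (rule filterlim_compose[OF tendsto_inverse_0 t])
    have "(\<lambda>n. coeff (Q (x n)) k) \<longlonglongrightarrow> coeff (Q y) k" for k
      by (rule continuous_on_tendsto_compose[OF
            continuous_on_complex_polynomial_function[OF coeff, of UNIV k] x]) auto
    then have "(\<lambda>n. \<Sum>k\<le>d. coeff (Q (x n)) k * inverse (t n) ^ (d - k))
        \<longlonglongrightarrow> (\<Sum>k\<le>d. coeff (Q y) k * 0 ^ (d - k))"
      using inv by (intro tendsto_intros)
    also have "(\<Sum>k\<le>d. coeff (Q y) k * 0 ^ (d - k)) = (\<Sum>k\<in>{d}. coeff (Q y) k * 0 ^ (d - k))"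
      by (rule sum.mono_neutral_right) auto
    finally have lim: "(\<lambda>n. \<Sum>k\<le>d. coeff (Q (x n)) k * inverse (t n) ^ (d - k)) \<longlonglongrightarrow> h y"
      by (simp add: h_def)
    have "eventually (\<lambda>n. t n \<noteq> 0) sequentially"
      using filterlim_at_infinity_imp_eventually_ne[OF t] .
    then have "eventually (\<lambda>n. (\<Sum>k\<le>d. coeff (Q (x n)) k * inverse (t n) ^ (d - k)) = 0) sequentially"
    proof eventually_elim
      case (elim n)
      have "(\<Sum>k\<le>d. coeff (Q (x n)) k * inverse (t n) ^ (d - k))
          = (\<Sum>k\<le>d. coeff (Q (x n)) k * t n ^ k) * inverse (t n) ^ d"
        unfolding sum_distrib_right
        by (rule sum.cong) (use elim in \<open>auto simp: power_diff field_simps\<close>)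
      also have "\<dots> = 0"
        using zero[of n] by (simp add: expand)
      finally show ?case .
    qed
    then have "(\<lambda>n. \<Sum>k\<le>d. coeff (Q (x n)) k * inverse (t n) ^ (d - k)) \<longlonglongrightarrow> 0"
      by (rule tendsto_eventually)
    then show ?thesis
      using lim LIMSEQ_unique by blast
  qed
  obtain x1 where "h x1 \<noteq> 0"
    using \<open>d \<in> K\<close> by (auto simp: K_def h_def)
  with that scale limit coeff show ?thesis
    unfolding h_def by blast
qed

text \<open>Dehomogenize: off the axis \<open>x $ 2 = 0\<close> the zeros of \<open>h\<close> have slopes that are roots of the one-variable
  polynomial \<open>t \<mapsto> h (t, 1)\<close>. The axis itself contributes at most one more line. If that one-variable polynomial
  vanished identically, so would \<open>h\<close>.\<close>
lemma form_vanishes_on_finitely_many_lines: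
  fixes h :: "complex ^ 2 \<Rightarrow> complex"
  assumes h: "complex_polynomial_function h" and nz: "h x1 \<noteq> 0"
    and scale: "\<And>c x. h (c *s x) = c ^ d * h x"
  obtains R where "finite R" "\<And>x. h x = 0 \<Longrightarrow> \<exists>v\<in>R. \<exists>c. x = c *s v"
proof -
  let ?e1 = "axis 1 1 :: complex ^ 2" and ?e2 = "axis 2 1 :: complex ^ 2"
  obtain q where q: "\<And>t. h (?e2 + t *s ?e1) = poly q t"
    using polynomial_on_line[OF h] by metis
  have decomp: "x = x $ 2 *s (?e2 + (x $ 1 / x $ 2) *s ?e1)" if "x $ 2 \<noteq> 0" for x :: "complex ^ 2"
    using that by (simp add: vec_eq_iff forall_2 axis_def)
  have "q \<noteq> 0"
  proof
    assume "q = 0"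
    then have off: "h x = 0" if "x $ 2 \<noteq> 0" for x
      using decomp[OF that] scale q by (metis mult_zero_right poly_0)
    obtain r where r: "\<And>t. h (x1 + t *s ?e2) = poly r t"
      using polynomial_on_line[OF h] by metis
    have "poly r t = 0" if "t \<noteq> - (x1 $ 2)" for t
    proof -
      have "(x1 + t *s ?e2) $ 2 = x1 $ 2 + t"
        by (simp add: axis_def)
      moreover have "x1 $ 2 + t \<noteq> 0"
        using that by (metis add_eq_0_iff)
      ultimately show ?thesis
        using off r by metis
    qed
    then have "UNIV - {- (x1 $ 2)} \<subseteq> {t. poly r t = 0}"
      by auto
    moreover have "infinite (UNIV - {- (x1 $ 2)} :: complex set)"
      by (simp add: infinite_UNIV_char_0)
    ultimately have "r = 0"
      using poly_roots_finite finite_subset by blast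
    with r[of 0] nz show False by simp
  qed
  define R where "R = insert ?e1 ((\<lambda>t. ?e2 + t *s ?e1) ` {t. poly q t = 0})"
  show ?thesis
  proof
    show "finite R"
      using poly_roots_finite[OF \<open>q \<noteq> 0\<close>] by (simp add: R_def)
    fix x assume "h x = 0"
    show "\<exists>v\<in>R. \<exists>c. x = c *s v"
    proof (cases "x $ 2 = 0")
      case True
      then have "x = x $ 1 *s ?e1"
        by (simp add: vec_eq_iff forall_2 axis_def)
      then show ?thesis by (auto simp: R_def)
    next
      case False
      have "poly q (x $ 1 / x $ 2) = 0"
        using \<open>h x = 0\<close> False decomp[OF False] scale q by (metis mult_eq_0_iff power_not_zero)
      with decomp[OF False] show ?thesis
        unfolding R_def by blast
    qed
  qed
qed

section \<open>Unions of coordinate lines are algebraic curves\<close>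

lemma algebraic_set_Int:
  assumes "algebraic_set X" "algebraic_set Y"
  shows "algebraic_set (X \<inter> Y)"
proof -
  obtain F G where "finite F" "\<forall>f\<in>F. complex_polynomial_function f" "X = {x. \<forall>f\<in>F. f x = 0}"
    "finite G" "\<forall>f\<in>G. complex_polynomial_function f" "Y = {x. \<forall>f\<in>G. f x = 0}"
    using assms unfolding algebraic_set_def by blast
  then show ?thesis
    unfolding algebraic_set_def by (intro exI[of _ "F \<union> G"]) auto
qed

lemma algebraic_set_Un:
  assumes "algebraic_set X" "algebraic_set Y"
  shows "algebraic_set (X \<union> Y)"
proof -
  obtain F G where F: "finite F" "\<forall>f\<in>F. complex_polynomial_function f" "X = {x. \<forall>f\<in>F. f x = 0}"
    and G: "finite G" "\<forall>f\<in>G. complex_polynomial_function f" "Y = {x. \<forall>f\<in>G. f x = 0}"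
    using assms unfolding algebraic_set_def by blast
  let ?H = "(\<lambda>(f, g) x. f x * g x) ` (F \<times> G)"
  have "finite ?H" "\<forall>f\<in>?H. complex_polynomial_function f"
    using F G by (auto intro: complex_polynomial_function.mult)
  moreover have "X \<union> Y = {x. \<forall>f\<in>?H. f x = 0}"
    unfolding F(3) G(3) by force
  ultimately show ?thesis
    unfolding algebraic_set_def by blast
qed

definition coordinate_line :: "'n \<Rightarrow> complex ^ 'n \<Rightarrow> (complex ^ 'n) set" where
  "coordinate_line i a = {x. \<forall>m. m \<noteq> i \<longrightarrow> x $ m = a $ m}"

lemma coordinate_line_eq:
  "coordinate_line i a = range (\<lambda>t. a + t *s axis i 1)"
proof (intro equalityI subsetI)
  fix x assume "x \<in> coordinate_line i a"
  then have "x = a + (x $ i - a $ i) *s axis i 1"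
    by (auto simp: coordinate_line_def vec_eq_iff axis_def)
  then show "x \<in> range (\<lambda>t. a + t *s axis i 1)" by blast
qed (auto simp: coordinate_line_def axis_def)

lemma algebraic_set_fixed_coordinates:
  fixes a :: "complex ^ 'n"
  shows "algebraic_set {x. \<forall>m\<in>M. x $ m = a $ m}"
  unfolding algebraic_set_def
proof (intro exI conjI)
  let ?F = "(\<lambda>m x. x $ m + (- a $ m)) ` M"
  show "finite ?F" by simp
  show "\<forall>f\<in>?F. complex_polynomial_function f"
    by (auto simp del: add_uminus_conv_diff intro!: complex_polynomial_function.intros)
  show "{x. \<forall>m\<in>M. x $ m = a $ m} = {x. \<forall>f\<in>?F. f x = 0}" by auto
qed

lemma algebraic_set_coordinate_line: "algebraic_set (coordinate_line i a)"
  using algebraic_set_fixed_coordinates[of "- {i}" a] by (simp add: coordinate_line_def Ball_def)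

lemma algebraic_set_singleton: "algebraic_set {a :: complex ^ 'n}"
  using algebraic_set_fixed_coordinates[of UNIV a] by (simp add: vec_eq_iff[symmetric])

text \<open>A polynomial function restricted to a line is a polynomial in one variable, hence vanishes identically
  or has finitely many zeros.\<close>
lemma algebraic_subset_coordinate_line:
  assumes "algebraic_set Y" "\<not> coordinate_line i a \<subseteq> Y"
  shows "finite (coordinate_line i a \<inter> Y)"
proof -
  obtain F where F: "\<forall>f\<in>F. complex_polynomial_function f" "Y = {x. \<forall>f\<in>F. f x = 0}"
    using assms(1) unfolding algebraic_set_def by blast
  obtain f t0 where f: "f \<in> F" "f (a + t0 *s axis i 1) \<noteq> 0"
    using assms(2) unfolding F(2) coordinate_line_eq by blast
  obtain q where q: "\<And>t. f (a + t *s axis i 1) = poly q t"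
    using polynomial_on_line F(1) f(1) by metis
  have "q \<noteq> 0" using f q by auto
  moreover have "coordinate_line i a \<inter> Y \<subseteq> (\<lambda>t. a + t *s axis i 1) ` {t. poly q t = 0}"
    using f(1) q unfolding F(2) coordinate_line_eq by force
  ultimately show ?thesis
    using poly_roots_finite finite_subset by blast
qed

lemma infinite_coordinate_line: "infinite (coordinate_line i a)"
proof -
  have "inj (\<lambda>t :: complex. a + t *s axis i 1)"
    by (auto simp: inj_on_def vec_eq_iff axis_def)
  then show ?thesis
    unfolding coordinate_line_eq using finite_imageD infinite_UNIV_char_0 by blast
qed

lemma irreducible_coordinate_line: "irreducible_algebraic_set (coordinate_line i a)"
  unfolding irreducible_algebraic_set_def
proof (intro conjI allI impI)
  show "coordinate_line i a \<noteq> {}"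
    using infinite_coordinate_line by (metis finite.emptyI)
next
  fix Y Z assume *: "algebraic_set Y \<and> algebraic_set Z \<and> coordinate_line i a = Y \<union> Z"
  show "Y = coordinate_line i a \<or> Z = coordinate_line i a"
  proof (rule ccontr)
    assume "\<not> ?thesis"
    then have "\<not> coordinate_line i a \<subseteq> Y" "\<not> coordinate_line i a \<subseteq> Z"
      using * by blast+
    then have "finite (coordinate_line i a \<inter> Y)" "finite (coordinate_line i a \<inter> Z)"
      using * algebraic_subset_coordinate_line by blast+
    then have "finite (coordinate_line i a)"
      using * by (metis Int_Un_distrib finite_Un inf.idem)
    then show False using infinite_coordinate_line by blast
  qed
qed (rule algebraic_set_coordinate_line)

lemma irreducible_singleton: "irreducible_algebraic_set {a :: complex ^ 'n}"
  unfolding irreducible_algebraic_set_def using algebraic_set_singleton by blast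

lemma algebraic_set_Union:
  "finite \<L> \<Longrightarrow> (\<And>X. X \<in> \<L> \<Longrightarrow> algebraic_set X) \<Longrightarrow> algebraic_set (\<Union>\<L>)"
proof (induction rule: finite_induct)
  case empty
  show ?case unfolding algebraic_set_def
    by (intro exI[of _ "{\<lambda>x. 1}"]) (auto intro: complex_polynomial_function.const)
qed (auto intro: algebraic_set_Un)

lemma algebraic_set_finite:
  fixes A :: "(complex ^ 'n) set"
  assumes "finite A"
  shows "algebraic_set A"
  using algebraic_set_Union[of "(\<lambda>x. {x}) ` A"] assms algebraic_set_singleton by auto

lemma irreducible_finite_is_singleton:
  assumes "irreducible_algebraic_set Z" "finite Z"
  obtains z where "Z = {z}"
proof -
  obtain z where z: "z \<in> Z"
    using assms(1) by (auto simp: irreducible_algebraic_set_def)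
  have "{z} = Z \<or> Z - {z} = Z"
    using assms z algebraic_set_finite[of "Z - {z}"] algebraic_set_singleton[of z]
    unfolding irreducible_algebraic_set_def by (metis finite_Diff insert_Diff insert_is_Un)
  then show ?thesis using z that by blast
qed

lemma irreducible_subset_Un:
  assumes "irreducible_algebraic_set Z" "algebraic_set X" "algebraic_set Y" "Z \<subseteq> X \<union> Y"
  shows "Z \<subseteq> X \<or> Z \<subseteq> Y"
proof -
  have "Z = (Z \<inter> X) \<union> (Z \<inter> Y)" using assms(4) by blast
  moreover have "algebraic_set Z"
    and irr: "\<And>V W. \<lbrakk>algebraic_set V; algebraic_set W; Z = V \<union> W\<rbrakk> \<Longrightarrow> V = Z \<or> W = Z"
    using assms(1) unfolding irreducible_algebraic_set_def by blast+
  ultimately have "Z \<inter> X = Z \<or> Z \<inter> Y = Z"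
    using assms(2,3) by (intro irr algebraic_set_Int)
  then show ?thesis by blast
qed

lemma irreducible_subset_Union:
  assumes "finite \<L>" "\<And>X. X \<in> \<L> \<Longrightarrow> algebraic_set X"
    and "irreducible_algebraic_set Z" "Z \<subseteq> \<Union>\<L>"
  shows "\<exists>X\<in>\<L>. Z \<subseteq> X"
  using assms
proof (induction rule: finite_induct)
  case empty
  then show ?case by (auto simp: irreducible_algebraic_set_def)
next
  case (insert X \<L>)
  then have "Z \<subseteq> X \<or> Z \<subseteq> \<Union>\<L>"
    by (intro irreducible_subset_Un) (auto intro: algebraic_set_Union)
  with insert show ?case by blast
qed

text \<open>Through a point \<open>x\<close> of the union passes one of its lines, and \<open>{x}\<close> inside that line is a chain of length 1.
  A chain of length 2 is impossible: its member \<open>Z 2\<close> is irreducible, so it lies in a single line. Then \<open>Z 1\<close>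
  misses a point of that line, so it is finite, and being irreducible it is a single point. This leaves no
  room for \<open>Z 0\<close>.\<close>
lemma algebraic_curve_Union_coordinate_lines:
  fixes I :: "('n \<times> (complex ^ 'n)) set"
  assumes "finite I"
  shows "algebraic_curve (\<Union>(i, a)\<in>I. coordinate_line i a)"
  unfolding algebraic_curve_def
proof (intro conjI ballI)
  let ?C = "\<Union>(i, a)\<in>I. coordinate_line i a"
  show "algebraic_set ?C"
    using assms by (intro algebraic_set_Union) (auto intro: algebraic_set_coordinate_line)
  fix x assume "x \<in> ?C"
  then obtain i a where ia: "(i, a) \<in> I" "x \<in> coordinate_line i a" by blast
  let ?S = "{d. \<exists>Z. x \<in> Z 0 \<and> (\<forall>i\<le>d. irreducible_algebraic_set (Z i) \<and> Z i \<subseteq> ?C) \<and>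
              (\<forall>i<d. Z i \<subset> Z (Suc i))}"
  have "{x} \<subset> coordinate_line i a"
    using ia(2) infinite_coordinate_line[of i a] by (metis bot.extremum finite.simps insert_subset psubsetI)
  then have "1 \<in> ?S"
    using ia irreducible_coordinate_line[of i a] irreducible_singleton[of x]
    by (intro CollectI exI[of _ "\<lambda>n. if n = 0 then {x} else coordinate_line i a"]) auto
  moreover have "d \<le> 1" if "d \<in> ?S" for d
  proof (rule ccontr)
    assume "\<not> d \<le> 1"
    from that obtain Z where Z: "x \<in> Z 0" "\<forall>i\<le>d. irreducible_algebraic_set (Z i) \<and> Z i \<subseteq> ?C"
        "\<forall>i<d. Z i \<subset> Z (Suc i)"
      by blast
    with \<open>\<not> d \<le> 1\<close> have Z01: "Z 0 \<subset> Z 1" and Z12: "Z 1 \<subset> Z 2"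
      and irr: "irreducible_algebraic_set (Z 1)" "irreducible_algebraic_set (Z 2)"
      and "Z 2 \<subseteq> ?C"
      by (auto simp: numeral_2_eq_2)
    have "\<exists>X\<in>(\<lambda>(i, a). coordinate_line i a) ` I. Z 2 \<subseteq> X"
      using assms irr(2) \<open>Z 2 \<subseteq> ?C\<close>
      by (intro irreducible_subset_Union) (auto intro: algebraic_set_coordinate_line)
    then obtain j b where "Z 2 \<subseteq> coordinate_line j b" by auto
    then have "finite (coordinate_line j b \<inter> Z 1)"
      using Z12 irr(1)
      by (intro algebraic_subset_coordinate_line) (auto simp: irreducible_algebraic_set_def)
    moreover have "coordinate_line j b \<inter> Z 1 = Z 1"
      using \<open>Z 2 \<subseteq> coordinate_line j b\<close> Z12 by blast
    ultimately obtain z where "Z 1 = {z}"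
      using irreducible_finite_is_singleton[OF irr(1)] by metis
    with Z(1) Z01 show False
      by (metis emptyE psubset_eq subset_singletonD)
  qed
  ultimately have "(SUP d\<in>?S. enat d) = 1"
    by (intro antisym SUP_least SUP_upper2[of 1]) (auto simp: one_enat_def)
  then show "algebraic_dim_at ?C x = 1"
    by (simp add: algebraic_dim_at_def)
qed

section \<open>Inner distance\<close>

text \<open>Bounding lengths by Lipschitz constants of parametrizations on \<open>[0, 1]\<close> loses a constant factor at each
  concatenation, which is harmless for being Lipschitz normally embedded, and avoids the additivity of length.\<close>
lemma inner_dist_le_lipschitz:
  assumes lip: "M-lipschitz_on {0..1} g" and "path_image g \<subseteq> S"
    and "pathstart g = x" "pathfinish g = y"
  shows "inner_dist S x y \<le> ennreal M"
proof -
  have "M \<ge> 0" using lip lipschitz_on_nonneg by blast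
  have "(\<Sum>i<n. ennreal (dist (g (t i)) (g (t (Suc i))))) \<le> ennreal M"
    if t: "mono_on {..n} t" "t ` {..n} \<subseteq> {0..1}" for n :: nat and t :: "nat \<Rightarrow> real"
  proof -
    have t01: "t m \<in> {0..1}" if "m \<le> n" for m
      using t(2) that by (meson atMost_iff image_subset_iff)
    have "(\<Sum>i<n. dist (g (t i)) (g (t (Suc i)))) \<le> (\<Sum>i<n. M * (t (Suc i) - t i))"
    proof (rule sum_mono)
      fix i assume i: "i \<in> {..<n}"
      then have "t i \<le> t (Suc i)" by (intro mono_onD[OF t(1)]) auto
      moreover have "t i \<in> {0..1}" "t (Suc i) \<in> {0..1}" using t01[of i] t01[of "Suc i"] i by auto
      ultimately show "dist (g (t i)) (g (t (Suc i))) \<le> M * (t (Suc i) - t i)"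
        using lipschitz_onD[OF lip, of "t i" "t (Suc i)"] by (simp add: dist_real_def)
    qed
    also have "\<dots> = M * (t n - t 0)"
      by (simp add: sum_distrib_left[symmetric] sum_lessThan_telescope)
    also have "\<dots> \<le> M * 1"
    proof (rule mult_left_mono)
      have "t n \<in> {0..1}" "t 0 \<in> {0..1}" using t01 by auto
      then show "t n - t 0 \<le> 1" by simp
    qed fact
    finally show ?thesis
      by (simp add: sum_ennreal ennreal_leI)
  qed
  then have len: "path_length g \<le> ennreal M"
    unfolding path_length_def by (intro SUP_least) auto
  moreover have "path g"
    using lipschitz_on_continuous_on[OF lip] by (simp add: path_def)
  ultimately have "rectifiable_path g"
    unfolding rectifiable_path_def using ennreal_less_top le_less_trans by fastforce
  then have "inner_dist S x y \<le> path_length g"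
    unfolding inner_dist_def using assms by (intro INF_lower) auto
  with len show ?thesis by (rule order_trans[rotated])
qed

lemma lipschitz_on_joinpaths:
  assumes "M-lipschitz_on {0..1} g1" "M-lipschitz_on {0..1} g2" "pathfinish g1 = pathstart g2"
  shows "(2 * M)-lipschitz_on {0..1} (g1 +++ g2)"
proof -
  have "M \<ge> 0" using assms lipschitz_on_nonneg by blast
  have 1: "(2 * M)-lipschitz_on {0..1/2} (\<lambda>x. g1 (2 * x))"
  proof (rule lipschitz_onI)
    fix x y :: real assume "x \<in> {0..1/2}" "y \<in> {0..1/2}"
    then show "dist (g1 (2 * x)) (g1 (2 * y)) \<le> 2 * M * dist x y"
      using lipschitz_onD[OF assms(1), of "2 * x" "2 * y"] by (simp add: dist_real_def abs_if algebra_simps split: if_splits)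
  qed (use \<open>M \<ge> 0\<close> in auto)
  have 2: "(2 * M)-lipschitz_on {1/2..1} (\<lambda>x. g2 (2 * x - 1))"
  proof (rule lipschitz_onI)
    fix x y :: real assume "x \<in> {1/2..1}" "y \<in> {1/2..1}"
    then show "dist (g2 (2 * x - 1)) (g2 (2 * y - 1)) \<le> 2 * M * dist x y"
      using lipschitz_onD[OF assms(2), of "2 * x - 1" "2 * y - 1"]
      by (simp add: dist_real_def abs_if algebra_simps split: if_splits)
  qed (use \<open>M \<ge> 0\<close> in auto)
  show ?thesis
    unfolding joinpaths_def
    using lipschitz_on_concat[OF 1 2] assms(3) by (simp add: pathfinish_def pathstart_def)
qed

lemma lipschitz_on_linepath:
  fixes a b :: "'a::real_normed_vector"
  assumes "dist a b \<le> M"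
  shows "M-lipschitz_on {0..1} (linepath a b)"
proof (rule lipschitz_onI)
  fix x y :: real
  have "linepath a b x - linepath a b y = (x - y) *\<^sub>R (b - a)"
    by (simp add: linepath_def algebra_simps)
  then have "dist (linepath a b x) (linepath a b y) = dist a b * dist x y"
    by (simp add: dist_norm norm_minus_commute)
  then show "dist (linepath a b x) (linepath a b y) \<le> M * dist x y"
    using assms by (simp add: mult_right_mono)
qed (use assms zero_le_dist order_trans in blast)

lemma inner_dist_le_three_segments:
  fixes x y :: "'a::real_normed_vector"
  assumes "closed_segment x p \<subseteq> S" "closed_segment p q \<subseteq> S" "closed_segment q y \<subseteq> S"
    and "dist x p \<le> M" "dist p q \<le> M" "dist q y \<le> M"
  shows "inner_dist S x y \<le> ennreal (4 * M)"
proof (rule inner_dist_le_lipschitz)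
  let ?g = "linepath x p +++ (linepath p q +++ linepath q y)"
  have "M \<ge> 0" using assms(4) zero_le_dist order_trans by blast
  have "(2 * (2 * M))-lipschitz_on {0..1} ?g"
    using assms \<open>M \<ge> 0\<close>
    by (intro lipschitz_on_joinpaths lipschitz_on_linepath) auto
  then show "(4 * M)-lipschitz_on {0..1} ?g" by simp
  show "path_image ?g \<subseteq> S"
    using assms by (simp add: path_image_join)
qed auto


section \<open>A chain of three lines\<close>

lemma closed_segment_coordinate_line:
  assumes "x \<in> coordinate_line i a" "y \<in> coordinate_line i a"
  shows "closed_segment x y \<subseteq> coordinate_line i a"
proof
  fix z assume "z \<in> closed_segment x y"
  then obtain u where "z = (1 - u) *\<^sub>R x + u *\<^sub>R y" by (auto simp: in_segment)
  then show "z \<in> coordinate_line i a"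
    using assms by (auto simp: coordinate_line_def scaleR_left_distrib[symmetric])
qed

lemma dist_coordinate_line:
  assumes "x \<in> coordinate_line i a" "y \<in> coordinate_line i a"
  shows "dist x y = norm (x $ i - y $ i)"
proof -
  have "x - y = axis i (x $ i - y $ i)"
    using assms by (auto simp: coordinate_line_def vec_eq_iff axis_def)
  then show ?thesis
    by (simp add: dist_norm norm_eq_sqrt_inner[of "axis i _"] inner_axis_axis norm_eq_sqrt_inner[symmetric])
qed

text \<open>The first and the last line are skew: the middle line meets the first in \<open>0\<close> and the last in
  \<open>axis k 1\<close>, and makes the chain connected.\<close>
definition three_line_chain :: "'n \<Rightarrow> 'n \<Rightarrow> 'n \<Rightarrow> (complex ^ 'n) set" where
  "three_line_chain i j k =
     coordinate_line i 0 \<union> coordinate_line k 0 \<union> coordinate_line j (axis k 1)"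

lemma algebraic_curve_three_line_chain: "algebraic_curve (three_line_chain i j k)"
  using algebraic_curve_Union_coordinate_lines[of "{(i, 0), (k, 0), (j, axis k 1)}"]
  by (simp add: three_line_chain_def Un_assoc)

text \<open>Two points are joined by walking along the chain through the intersection points in between. Since the
  lines point in different coordinate directions, each leg of this walk is the difference of the two end points
  in one coordinate, hence at most their outer distance. There are at most three legs.\<close>
lemma lipschitz_normally_embedded_three_line_chain:
  fixes i j k :: "'n::finite"
  assumes ne: "i \<noteq> j" "i \<noteq> k" "j \<noteq> k"
  shows "lipschitz_normally_embedded (three_line_chain i j k)"
proof -
  let ?L1 = "coordinate_line i 0" and ?L2 = "coordinate_line k 0"
    and ?L3 = "coordinate_line j (axis k 1)"
  let ?C = "three_line_chain i j k" and ?e = "axis k 1 :: complex ^ 'n"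
  have sub: "?L1 \<subseteq> ?C" "?L2 \<subseteq> ?C" "?L3 \<subseteq> ?C"
    by (auto simp: three_line_chain_def)
  have mem: "0 \<in> ?L1" "0 \<in> ?L2" "?e \<in> ?L2" "?e \<in> ?L3"
    by (auto simp: coordinate_line_def axis_def)
  have seg1: "closed_segment u v \<subseteq> ?C" if "u \<in> ?L1" "v \<in> ?L1" for u v
    using closed_segment_coordinate_line[OF that] sub(1) by (rule order_trans)
  have seg2: "closed_segment u v \<subseteq> ?C" if "u \<in> ?L2" "v \<in> ?L2" for u v
    using closed_segment_coordinate_line[OF that] sub(2) by (rule order_trans)
  have seg3: "closed_segment u v \<subseteq> ?C" if "u \<in> ?L3" "v \<in> ?L3" for u v
    using closed_segment_coordinate_line[OF that] sub(3) by (rule order_trans)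
  have comp: "norm (x $ m - y $ m) \<le> dist x y" for x y :: "complex ^ 'n" and m
    using Finite_Cartesian_Product.norm_nth_le[of "x - y" m] by (simp add: dist_norm)
  define G where "G x y \<longleftrightarrow> inner_dist ?C x y \<le> ennreal (4 * dist x y)" for x y
  have same: "G x y" if "closed_segment x y \<subseteq> ?C" for x y
    unfolding G_def by (rule inner_dist_le_three_segments[of x x _ x]) (use that in auto)
  have 12: "G x y" "G y x" if x: "x \<in> ?L1" and y: "y \<in> ?L2" for x y
  proof -
    have le: "dist x 0 \<le> dist x y" "dist 0 y \<le> dist x y"
      using comp[where x = x and y = y and m = i] comp[where x = x and y = y and m = k] x y
        dist_coordinate_line[OF x mem(1)] dist_coordinate_line[OF mem(2) y] ne
      by (auto simp: coordinate_line_def)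
    show "G x y" unfolding G_def
      by (rule inner_dist_le_three_segments[OF seg1[OF x mem(1)] seg2[OF mem(2) y] seg2[OF y y]])
        (use le in auto)
    show "G y x" unfolding G_def
      by (rule inner_dist_le_three_segments[OF seg2[OF y y] seg2[OF y mem(2)] seg1[OF mem(1) x]])
        (use le in \<open>auto simp: dist_commute\<close>)
  qed
  have 23: "G x y" "G y x" if x: "x \<in> ?L2" and y: "y \<in> ?L3" for x y
  proof -
    have le: "dist x ?e \<le> dist x y" "dist ?e y \<le> dist x y"
      using comp[where x = x and y = y and m = k] comp[where x = x and y = y and m = j] x y
        dist_coordinate_line[OF x mem(3)] dist_coordinate_line[OF mem(4) y] ne
      by (auto simp: coordinate_line_def axis_def)
    show "G x y" unfolding G_def
      by (rule inner_dist_le_three_segments[OF seg2[OF x mem(3)] seg3[OF mem(4) y] seg3[OF y y]])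
        (use le in auto)
    show "G y x" unfolding G_def
      by (rule inner_dist_le_three_segments[OF seg3[OF y y] seg3[OF y mem(4)] seg2[OF mem(3) x]])
        (use le in \<open>auto simp: dist_commute\<close>)
  qed
  have 13: "G x y" "G y x" if x: "x \<in> ?L1" and y: "y \<in> ?L3" for x y
  proof -
    have le: "dist x 0 \<le> dist x y" "dist 0 ?e \<le> dist x y" "dist ?e y \<le> dist x y"
      using comp[where x = x and y = y and m = i] comp[where x = x and y = y and m = k]
        comp[where x = x and y = y and m = j] x y
        dist_coordinate_line[OF x mem(1)] dist_coordinate_line[OF mem(2,3)]
        dist_coordinate_line[OF mem(4) y] ne
      by (auto simp: coordinate_line_def axis_def)
    show "G x y" unfolding G_def
      by (rule inner_dist_le_three_segments[OF seg1[OF x mem(1)] seg2[OF mem(2,3)] seg3[OF mem(4) y]])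
        (use le in auto)
    show "G y x" unfolding G_def
      by (rule inner_dist_le_three_segments[OF seg3[OF y mem(4)] seg2[OF mem(3,2)] seg1[OF mem(1) x]])
        (use le in \<open>auto simp: dist_commute\<close>)
  qed
  have "G x y" if "x \<in> ?C" "y \<in> ?C" for x y
    using that same seg1 seg2 seg3 12 23 13 unfolding three_line_chain_def by (elim UnE) simp_all
  then show ?thesis
    unfolding lipschitz_normally_embedded_def G_def by (intro exI[of _ 4]) auto
qed

section \<open>Disjoint bi-Lipschitz planes in a plane curve\<close>

text \<open>The entries of the orthogonal projection onto the span of \<open>\<gamma> s\<close> depend continuously on \<open>s\<close> and take only
  finitely many values, so they are constant on a connected set. The first row of the projection already
  determines the line.\<close>
lemma connected_in_finitely_many_lines:
  fixes \<gamma> :: "'a::topological_space \<Rightarrow> complex ^ 2"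
  assumes S: "connected S" and cont: "continuous_on S \<gamma>" and nz: "\<And>s. s \<in> S \<Longrightarrow> \<gamma> s \<noteq> 0"
    and R: "finite R" "\<And>s. s \<in> S \<Longrightarrow> \<exists>v\<in>R. \<exists>c. \<gamma> s = c *s v"
  obtains v where "v \<noteq> 0" "\<And>s. s \<in> S \<Longrightarrow> \<exists>c. \<gamma> s = c *s v"
proof (cases "S = {}")
  case True
  have "axis 1 1 \<noteq> (0 :: complex ^ 2)" by (simp add: vec_eq_iff axis_def)
  with True that show ?thesis by blast
next
  case False
  then obtain s0 where s0: "s0 \<in> S" by blast
  define N where "N x = x $ 1 * cnj (x $ 1) + x $ 2 * cnj (x $ 2)" for x :: "complex ^ 2"
  \<comment> \<open>\<open>w m x\<close> is the entry in row 1 and column \<open>m\<close> of the orthogonal projection onto the span of \<open>x\<close>.\<close>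
  define w where "w m x = x $ 1 * cnj (x $ m) / N x" for m and x :: "complex ^ 2"
  have N: "N x \<noteq> 0" if "x \<noteq> 0" for x
  proof
    assume "N x = 0"
    then have "complex_of_real ((cmod (x $ 1))\<^sup>2 + (cmod (x $ 2))\<^sup>2) = 0"
      by (simp add: N_def complex_norm_square del: of_real_power)
    then have "(cmod (x $ 1))\<^sup>2 + (cmod (x $ 2))\<^sup>2 = 0"
      by (metis of_real_eq_0_iff)
    then have "x $ 1 = 0 \<and> x $ 2 = 0"
      by (simp add: sum_power2_eq_zero_iff)
    with that show False by (simp add: vec_eq_iff forall_2)
  qed
  have scale: "w m (c *s x) = w m x" if "c \<noteq> 0" for m c x
  proof -
    have "N (c *s x) = c * cnj c * N x"
      by (simp add: N_def algebra_simps)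
    moreover have "(c *s x) $ 1 * cnj ((c *s x) $ m) = c * cnj c * (x $ 1 * cnj (x $ m))"
      by simp
    ultimately show ?thesis
      using that by (simp only: w_def) simp
  qed
  have const: "w m (\<gamma> s) = w m (\<gamma> s0)" if "s \<in> S" for m s
  proof -
    have "w m (\<gamma> s) \<in> w m ` R" if s: "s \<in> S" for s
    proof -
      obtain v c where v: "v \<in> R" "\<gamma> s = c *s v" using R(2)[OF s] by blast
      moreover have "c \<noteq> 0" using nz[OF s] v by auto
      ultimately show ?thesis using scale by auto
    qed
    then have "finite ((\<lambda>s. w m (\<gamma> s)) ` S)"
      using R(1) by (meson finite_imageI finite_subset image_subsetI)
    moreover have "continuous_on S (\<lambda>s. w m (\<gamma> s))"
      unfolding w_def using N nz unfolding N_def by (intro continuous_intros cont) auto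
    ultimately have "(\<lambda>s. w m (\<gamma> s)) constant_on S"
      using continuous_finite_range_constant[OF S] by blast
    then show ?thesis
      using that s0 unfolding constant_on_def by metis
  qed
  have parallel: "\<gamma> s $ 1 * \<gamma> s0 $ 2 = \<gamma> s $ 2 * \<gamma> s0 $ 1" if s: "s \<in> S" for s
  proof -
    let ?x = "\<gamma> s" and ?y = "\<gamma> s0"
    have "N ?x \<noteq> 0" "N ?y \<noteq> 0" using N nz s s0 by auto
    then have eq: "?x $ 1 * cnj (?x $ m) * N ?y = ?y $ 1 * cnj (?y $ m) * N ?x" for m
      using const[OF s, of m] by (simp add: w_def field_simps)
    show ?thesis
    proof (cases "?x $ 1 = 0 \<or> ?y $ 1 = 0")
      case True
      with eq[of 1] \<open>N ?x \<noteq> 0\<close> \<open>N ?y \<noteq> 0\<close> have "?x $ 1 = 0 \<and> ?y $ 1 = 0" by auto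
      then show ?thesis by simp
    next
      case False
      have "(?x $ 1 * cnj (?x $ 1) * N ?y) * (?y $ 1 * cnj (?y $ 2) * N ?x)
          = (?y $ 1 * cnj (?y $ 1) * N ?x) * (?x $ 1 * cnj (?x $ 2) * N ?y)"
        by (simp only: eq[of 1] eq[of 2])
      then have "(?x $ 1 * ?y $ 1 * N ?x * N ?y) * (cnj (?x $ 1) * cnj (?y $ 2))
          = (?x $ 1 * ?y $ 1 * N ?x * N ?y) * (cnj (?x $ 2) * cnj (?y $ 1))"
        by (simp only: mult_ac)
      then have "cnj (?x $ 1) * cnj (?y $ 2) = cnj (?x $ 2) * cnj (?y $ 1)"
        using False \<open>N ?x \<noteq> 0\<close> \<open>N ?y \<noteq> 0\<close> by simp
      then have "cnj (?x $ 1 * ?y $ 2) = cnj (?x $ 2 * ?y $ 1)" by simp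
      then show ?thesis using complex_cnj_cancel_iff by blast
    qed
  qed
  have nz0: "\<gamma> s0 $ 1 \<noteq> 0 \<or> \<gamma> s0 $ 2 \<noteq> 0"
    using nz[OF s0] by (simp add: vec_eq_iff forall_2)
  show ?thesis
  proof (rule that[of "\<gamma> s0"])
    show "\<gamma> s0 \<noteq> 0" by (rule nz[OF s0])
    fix s assume s: "s \<in> S"
    show "\<exists>c. \<gamma> s = c *s \<gamma> s0"
    proof (cases "\<gamma> s0 $ 1 = 0")
      case True
      with parallel[OF s] nz0 show ?thesis
        by (intro exI[of _ "\<gamma> s $ 2 / \<gamma> s0 $ 2"]) (simp add: vec_eq_iff forall_2)
    next
      case False
      with parallel[OF s] show ?thesis
        by (intro exI[of _ "\<gamma> s $ 1 / \<gamma> s0 $ 1"]) (simp add: vec_eq_iff forall_2 field_simps)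
    qed
  qed
qed

text \<open>By invariance of domain \<open>G\<close> has a continuous inverse \<open>g\<close> on a closed ball around \<open>0\<close>. If \<open>F\<close> is close to \<open>G\<close>,
  then \<open>y \<mapsto> y - F (g y)\<close> maps this ball to itself, and Brouwer's fixed point is carried by \<open>g\<close> to a zero of \<open>F\<close>.\<close>
lemma zero_of_injective_map_persists:
  fixes G :: "'a::euclidean_space \<Rightarrow> 'b::euclidean_space"
  assumes "open U" "continuous_on U G" "inj_on G U" "DIM('b) \<le> DIM('a)"
    and x0: "x0 \<in> U" "G x0 = 0"
  obtains r where "r > 0"
    and "\<And>F. \<lbrakk>continuous_on U F; \<And>x. x \<in> U \<Longrightarrow> dist (F x) (G x) \<le> r\<rbrakk> \<Longrightarrow> \<exists>x\<in>U. F x = 0"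
proof -
  have "open (G ` U)"
    using assms by (intro invariance_of_domain_gen) auto
  then obtain r where r: "r > 0" "cball 0 r \<subseteq> G ` U"
    using x0 by (metis image_eqI open_contains_cball)
  obtain g where g: "homeomorphism U (G ` U) G g"
    using invariance_of_domain_homeomorphism assms by metis
  have "\<exists>x\<in>U. F x = 0"
    if F: "continuous_on U F" "\<And>x. x \<in> U \<Longrightarrow> dist (F x) (G x) \<le> r" for F
  proof -
    have gU: "g y \<in> U" "G (g y) = y" if "y \<in> cball 0 r" for y
    proof -
      have "y \<in> G ` U" using r(2) that by blast
      then show "g y \<in> U" "G (g y) = y"
        using homeomorphism_image2[OF g] homeomorphism_apply2[OF g] by auto
    qed
    have "continuous_on (cball 0 r) g"
      using g r(2) homeomorphism_cont2 continuous_on_subset by blast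
    moreover have "continuous_on (g ` cball 0 r) F"
      using F(1) gU(1) by (auto intro: continuous_on_subset)
    ultimately have "continuous_on (cball 0 r) (\<lambda>y. F (g y))"
      using continuous_on_compose2 by blast
    then have cont: "continuous_on (cball 0 r) (\<lambda>y. y - F (g y))"
      by (intro continuous_intros)
    have maps: "(\<lambda>y. y - F (g y)) \<in> cball 0 r \<rightarrow> cball 0 r"
      using F(2)[OF gU(1)] gU(2) by (force simp: dist_norm norm_minus_commute)
    obtain y where "y \<in> cball 0 r" "y - F (g y) = y"
      by (rule brouwer[OF compact_cball convex_cball _ cont maps]) (use r(1) in auto)
    then show ?thesis using gU by auto
  qed
  with r(1) that show ?thesis by blast
qed

text \<open>Two bi-Lipschitz copies \<open>A\<close>, \<open>B\<close> of \<open>\<complex>\<close> inside a plane curve that separate linearly at infinity must meet.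
  Blow them down: by Arzela--Ascoli the maps \<open>s \<mapsto> A (n s) / n\<close> and \<open>t \<mapsto> B (n t) / n\<close> converge along a subsequence,
  uniformly on the closed unit disc, to injective maps \<open>a\<close> and \<open>b\<close> that vanish at \<open>0\<close>. Their values are zeros of the leading
  form, so on the open disc \<open>a\<close> runs in one complex line and \<open>b\<close> in another. These two lines differ, since otherwise
  the image of \<open>a\<close> would be a neighbourhood of \<open>0\<close> in the line and would contain some \<open>b t\<close> with \<open>t \<noteq> 0\<close>.
  Therefore \<open>(s, t) \<mapsto> a s - b t\<close> is injective with a zero at the origin, and this zero persists in the nearby map
  \<open>(s, t) \<mapsto> (A (n s) - B (n t)) / n\<close>.\<close>
lemma asymptotic_planes_meet:
  fixes A B :: "complex \<Rightarrow> complex ^ 2"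
  assumes p: "complex_polynomial_function p" "p x0 \<noteq> 0"
    and zero: "\<And>s. p (A s) = 0" "\<And>t. p (B t) = 0"
    and up: "\<And>s s'. dist (A s) (A s') \<le> K * dist s s'" "\<And>t t'. dist (B t) (B t') \<le> K * dist t t'"
    and low: "\<And>s s'. dist s s' \<le> L * dist (A s) (A s')" "\<And>t t'. dist t t' \<le> L * dist (B t) (B t')"
    and apart: "\<And>s t. norm t \<le> L * dist (A s) (B t)"
  shows "\<exists>s t. A s = B t"
proof -
  define A' where "A' n s = A (real (Suc n) *\<^sub>R s) /\<^sub>R real (Suc n)" for n s
  define B' where "B' n t = B (real (Suc n) *\<^sub>R t) /\<^sub>R real (Suc n)" for n t
  have "0 \<le> dist (A 0) (A 1)" by simp
  also have "\<dots> \<le> K" using up(1)[of 0 1] by simp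
  finally have "K \<ge> 0" .
  have dist_scale: "dist (x /\<^sub>R c) (y /\<^sub>R c) = dist x y / c" if "c > 0"
    for x y :: "'b::real_normed_vector" and c
    using that by (simp add: dist_norm scaleR_diff_right[symmetric] divide_inverse mult.commute)
  have dist_scale': "dist (c *\<^sub>R x) (c *\<^sub>R y) = c * dist x y" if "c > 0"
    for x y :: "'b::real_normed_vector" and c
    using that by (simp add: dist_norm scaleR_diff_right[symmetric])
  have pos: "real (Suc n) > 0" for n by simp
  have up': "dist (A' n s) (A' n s') \<le> K * dist s s'" "dist (B' n s) (B' n s') \<le> K * dist s s'" for n s s'
    using up(1)[of "real (Suc n) *\<^sub>R s" "real (Suc n) *\<^sub>R s'"] up(2)[of "real (Suc n) *\<^sub>R s" "real (Suc n) *\<^sub>R s'"]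
    unfolding A'_def B'_def dist_scale[OF pos] dist_scale'[OF pos]
    by (simp_all add: pos_divide_le_eq mult_ac del: of_nat_Suc)
  have low': "dist s s' \<le> L * dist (A' n s) (A' n s')" "dist s s' \<le> L * dist (B' n s) (B' n s')" for n s s'
    using low(1)[of "real (Suc n) *\<^sub>R s" "real (Suc n) *\<^sub>R s'"] low(2)[of "real (Suc n) *\<^sub>R s" "real (Suc n) *\<^sub>R s'"]
    unfolding A'_def B'_def dist_scale[OF pos] dist_scale'[OF pos]
    by (simp_all add: pos_le_divide_eq mult_ac del: of_nat_Suc)
  have apart': "norm t \<le> L * dist (A' n s) (B' n t)" for n s t
    using apart[of "real (Suc n) *\<^sub>R t" "real (Suc n) *\<^sub>R s"]
    unfolding A'_def B'_def dist_scale[OF pos]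
    by (simp add: pos_le_divide_eq mult_ac del: of_nat_Suc)
  \<comment> \<open>Pairing the two families gives one subsequence along which both converge.\<close>
  define F where "F n s = (A' n s, B' n s)" for n s
  have Flip: "norm (F n x - F n y) \<le> 2 * K * norm (x - y)" for n x y
    using norm_Pair_le[of "A' n x - A' n y" "B' n x - B' n y"] up'(1)[of n x y] up'(2)[of n x y]
    by (simp add: F_def dist_norm)
  have F0: "norm (F n 0) \<le> norm (A 0) + norm (B 0)" for n
  proof -
    have "norm (x /\<^sub>R real (Suc n)) \<le> norm x" for x :: "complex ^ 2"
      by (simp add: divide_inverse[symmetric] mult.commute pos_divide_le_eq mult_left_le mult_le_cancel_left1)
    then show ?thesis
      using norm_Pair_le[of "A' n 0" "B' n 0"]
      by (simp add: F_def A'_def B'_def del: of_nat_Suc) (meson add_mono order_trans)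
  qed
  obtain g k where g: "continuous_on (cball 0 1) g" and k: "strict_mono (k :: nat \<Rightarrow> nat)"
    and unif: "\<And>e. 0 < e \<Longrightarrow> \<exists>N. \<forall>n x. n \<ge> N \<and> x \<in> cball 0 1 \<longrightarrow> norm (F (k n) x - g x) < e"
  proof (rule Arzela_Ascoli)
    show "compact (cball 0 1 :: complex set)" by simp
    show "norm (F n x) \<le> norm (A 0) + norm (B 0) + 2 * K" if "x \<in> cball 0 1" for n x
    proof -
      have "2 * K * norm x \<le> 2 * K"
        using that \<open>K \<ge> 0\<close> by (simp add: mult_left_le)
      then show ?thesis
        using Flip[of n x 0] F0[of n] norm_triangle_sub[of "F n x" "F n 0"] by simp
    qed
    show "\<exists>d. 0 < d \<and> (\<forall>n y. y \<in> cball 0 1 \<and> norm (x - y) < d \<longrightarrow> norm (F n x - F n y) < e)"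
      if "0 < e" for x e
    proof (intro exI[of _ "e / (2 * K + 1)"] conjI allI impI)
      show "0 < e / (2 * K + 1)" using that \<open>K \<ge> 0\<close> by simp
      fix n y assume "y \<in> cball 0 1 \<and> norm (x - y) < e / (2 * K + 1)"
      then have "(2 * K + 1) * norm (x - y) < e"
        using \<open>K \<ge> 0\<close> by (simp add: pos_less_divide_eq mult.commute)
      moreover have "2 * K * norm (x - y) \<le> (2 * K + 1) * norm (x - y)"
        by (simp add: mult_right_mono)
      ultimately show "norm (F n x - F n y) < e"
        using Flip[of n x y] by linarith
    qed
  qed blast
  define a where "a s = fst (g s)" for s
  define b where "b t = snd (g t)" for t
  have conta: "continuous_on (cball 0 1) a" and contb: "continuous_on (cball 0 1) b"
    unfolding a_def b_def by (intro continuous_intros g)+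
  have lim: "(\<lambda>n. F (k n) s) \<longlonglongrightarrow> g s" if "s \<in> cball 0 1" for s
    unfolding LIMSEQ_iff using unif that by meson
  have lima: "(\<lambda>n. A' (k n) s) \<longlonglongrightarrow> a s" if "s \<in> cball 0 1" for s
    using tendsto_fst[OF lim[OF that]] by (simp add: F_def a_def)
  have limb: "(\<lambda>n. B' (k n) s) \<longlonglongrightarrow> b s" if "s \<in> cball 0 1" for s
    using tendsto_snd[OF lim[OF that]] by (simp add: F_def b_def)
  have infty: "filterlim (\<lambda>n. real (Suc (k n))) at_top sequentially"
    using filterlim_compose[OF filterlim_real_sequentially
        filterlim_compose[OF filterlim_Suc filterlim_subseq[OF k]]] .
  have zero_lim: "(\<lambda>n. x /\<^sub>R real (Suc (k n))) \<longlonglongrightarrow> 0" for x :: "complex ^ 2"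
    using tendsto_scaleR[OF tendsto_inverse_0_at_top[OF infty] tendsto_const[of x]] by simp
  have a0: "a 0 = 0"
    by (rule LIMSEQ_unique[OF lima]) (use zero_lim in \<open>auto simp: A'_def\<close>)
  have b0: "b 0 = 0"
    by (rule LIMSEQ_unique[OF limb]) (use zero_lim in \<open>auto simp: B'_def\<close>)
  have lowa: "dist s s' \<le> L * dist (a s) (a s')" if "s \<in> cball 0 1" "s' \<in> cball 0 1" for s s'
    by (rule LIMSEQ_le_const[OF tendsto_mult_left[OF tendsto_dist[OF lima[OF that(1)] lima[OF that(2)]]]])
      (use low' in auto)
  have lowb: "dist s s' \<le> L * dist (b s) (b s')" if "s \<in> cball 0 1" "s' \<in> cball 0 1" for s s'
    by (rule LIMSEQ_le_const[OF tendsto_mult_left[OF tendsto_dist[OF limb[OF that(1)] limb[OF that(2)]]]])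
      (use low' in auto)
  have apartab: "norm t \<le> L * dist (a s) (b t)" if "s \<in> cball 0 1" "t \<in> cball 0 1" for s t
    by (rule LIMSEQ_le_const[OF tendsto_mult_left[OF tendsto_dist[OF lima[OF that(1)] limb[OF that(2)]]]])
      (use apart' in auto)
  obtain h d x1 where h: "complex_polynomial_function h" "h x1 \<noteq> 0"
    and hscale: "\<And>c x. h (c *s x) = c ^ d * h x"
    and hlim: "\<And>t x y. \<lbrakk>filterlim t at_infinity sequentially; x \<longlonglongrightarrow> y; \<And>n. p (t n *s x n) = 0\<rbrakk>
           \<Longrightarrow> h y = 0"
    using leading_form[OF p] by metis
  obtain R where R: "finite R" "\<And>x. h x = 0 \<Longrightarrow> \<exists>v\<in>R. \<exists>c. x = c *s v"
    using form_vanishes_on_finitely_many_lines[OF h hscale] by metis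
  have infty': "filterlim (\<lambda>n. complex_of_real (real (Suc (k n)))) at_infinity sequentially"
    by (rule filterlim_compose[OF filterlim_of_real_at_infinity infty])
  have rescale: "complex_of_real c *s (x /\<^sub>R c) = x" if "c > 0" for c and x :: "complex ^ 2"
    unfolding vec_eq_iff vector_smult_component vector_scaleR_component
    using that by (simp add: scaleR_conv_of_real)
  have ha: "h (a s) = 0" and hb: "h (b s) = 0" if "s \<in> cball 0 1" for s
    using hlim[OF infty' lima[OF that]] hlim[OF infty' limb[OF that]] zero
    by (simp_all add: A'_def B'_def rescale del: of_nat_Suc of_real_of_nat_eq)
  let ?U = "ball 0 1 :: complex set"
  have U: "s \<in> cball 0 1" if "s \<in> ?U" for s using that by simp
  have conn: "connected (?U - {0})"
    by (rule connected_punctured_ball) simp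
  have in_line: "\<exists>v. v \<noteq> 0 \<and> (\<forall>s\<in>?U. \<exists>z. c s = z *s v)"
    if c: "continuous_on (cball 0 1) c" "c 0 = 0" "\<And>s. s \<in> cball 0 1 \<Longrightarrow> h (c s) = 0"
      and low: "\<And>s s'. \<lbrakk>s \<in> cball 0 1; s' \<in> cball 0 1\<rbrakk> \<Longrightarrow> dist s s' \<le> L * dist (c s) (c s')"
    for c :: "complex \<Rightarrow> complex ^ 2"
  proof -
    have "continuous_on (?U - {0}) c"
      by (rule continuous_on_subset[OF c(1)]) auto
    moreover have "c s \<noteq> 0" if "s \<in> ?U - {0}" for s
      using low[of s 0] that c(2) by auto
    moreover have "\<exists>v\<in>R. \<exists>z. c s = z *s v" if "s \<in> ?U - {0}" for s
      using R(2) c(3)[of s] that by auto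
    ultimately obtain v where v: "v \<noteq> 0" "\<And>s. s \<in> ?U - {0} \<Longrightarrow> \<exists>z. c s = z *s v"
      using connected_in_finitely_many_lines[OF conn _ _ R(1)] by blast
    have "\<exists>z. c s = z *s v" if "s \<in> ?U" for s
    proof (cases "s = 0")
      case True
      then show ?thesis using c(2) by (intro exI[of _ 0]) simp
    qed (use v that in blast)
    with v(1) show ?thesis by blast
  qed
  obtain va where va: "va \<noteq> 0" "\<And>s. s \<in> ?U \<Longrightarrow> \<exists>z. a s = z *s va"
    using in_line[OF conta a0 ha lowa] by blast
  obtain vb where vb: "vb \<noteq> 0" "\<And>s. s \<in> ?U \<Longrightarrow> \<exists>z. b s = z *s vb"
    using in_line[OF contb b0 hb lowb] by blast
  have inja: "s = s'" if "a s = a s'" "s \<in> ?U" "s' \<in> ?U" for s s'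
    using lowa[OF U U, of s s'] that by simp
  have injb: "s = s'" if "b s = b s'" "s \<in> ?U" "s' \<in> ?U" for s s'
    using lowb[OF U U, of s s'] that by simp
  have contaU: "continuous_on ?U a" and contbU: "continuous_on ?U b"
    using conta contb by (auto elim: continuous_on_subset)
  \<comment> \<open>If the two lines agree, the coordinate \<open>m\<close> identifies their common line with \<open>\<complex>\<close>, where invariance of domain
      applies to \<open>a\<close>.\<close>
  have transversal: "vb \<noteq> c *s va" for c
  proof
    assume c: "vb = c *s va"
    obtain m where m: "va $ m \<noteq> 0" using va(1) by (auto simp: vec_eq_iff)
    have det: "x = (x $ m / va $ m) *s va" if "\<exists>z. x = z *s va" for x
      using that m by auto
    have am: "a s = (a s $ m / va $ m) *s va" if "s \<in> ?U" for s
      using det va(2)[OF that] by blast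
    have "\<exists>z. b s = z *s va" if "s \<in> ?U" for s
      using vb(2)[OF that] c by (metis vector_smult_assoc)
    then have bm: "b s = (b s $ m / va $ m) *s va" if "s \<in> ?U" for s
      using det that by blast
    have "open ((\<lambda>s. a s $ m) ` ?U)"
    proof (rule invariance_of_domain_gen)
      show "continuous_on ?U (\<lambda>s. a s $ m)" by (intro continuous_intros contaU)
      show "inj_on (\<lambda>s. a s $ m) ?U"
      proof (rule inj_onI)
        fix s s' assume s: "s \<in> ?U" "s' \<in> ?U" and eq: "a s $ m = a s' $ m"
        have "a s = (a s $ m / va $ m) *s va" by (rule am[OF s(1)])
        also have "\<dots> = a s'" unfolding eq by (rule am[OF s(2), symmetric])
        finally show "s = s'" using inja s by blast
      qed
    qed auto
    moreover have "continuous_on ?U (\<lambda>s. b s $ m)" by (intro continuous_intros contbU)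
    ultimately have "open (?U \<inter> (\<lambda>s. b s $ m) -` ((\<lambda>s. a s $ m) ` ?U))"
      by (metis continuous_on_open_vimage open_ball Int_commute)
    moreover have "0 \<in> ?U \<inter> (\<lambda>s. b s $ m) -` ((\<lambda>s. a s $ m) ` ?U)"
      using a0 b0 by (auto intro!: image_eqI[of _ _ 0])
    ultimately obtain e where e: "e > 0" "ball 0 e \<subseteq> ?U \<inter> (\<lambda>s. b s $ m) -` ((\<lambda>s. a s $ m) ` ?U)"
      using openE by blast
    define t where "t = complex_of_real (e / 2)"
    have "t \<noteq> 0" "t \<in> ball 0 e" using e(1) by (auto simp: t_def)
    then have "t \<in> ?U" "b t $ m \<in> (\<lambda>s. a s $ m) ` ?U" using e(2) by auto
    from this(2) obtain s where s: "b t $ m = a s $ m" "s \<in> ?U" by (rule imageE)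
    have "a s = (a s $ m / va $ m) *s va" by (rule am[OF \<open>s \<in> ?U\<close>])
    also have "\<dots> = b t" unfolding s(1)[symmetric] by (rule bm[OF \<open>t \<in> ?U\<close>, symmetric])
    finally have "a s = b t" .
    with apartab[OF U[OF \<open>s \<in> ?U\<close>] U[OF \<open>t \<in> ?U\<close>]] \<open>t \<noteq> 0\<close> show False by simp
  qed
  define G where "G = (\<lambda>(s, t). a s - b t)"
  have contG: "continuous_on (?U \<times> ?U) G"
    unfolding G_def case_prod_unfold
    by (intro continuous_intros continuous_on_compose2[OF contaU] continuous_on_compose2[OF contbU]) auto
  have injG: "inj_on G (?U \<times> ?U)"
  proof (clarsimp simp only: inj_on_def G_def mem_Times_iff split_paired_all fst_conv snd_conv prod.case prod.inject)
    fix s t s' t'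
    assume U': "s \<in> ?U" "t \<in> ?U" "s' \<in> ?U" "t' \<in> ?U" and eq: "a s - b t = a s' - b t'"
    obtain z z' y y' where z: "a s = z *s va" "a s' = z' *s va" "b t = y *s vb" "b t' = y' *s vb"
      using va(2) vb(2) U' by metis
    have *: "(z - z') *s va = (y - y') *s vb"
      using eq by (simp add: z vec_eq_iff algebra_simps)
    have "y = y'"
    proof (rule ccontr)
      assume "y \<noteq> y'"
      then have "vb = (1 / (y - y')) *s ((y - y') *s vb)"
        unfolding vector_smult_assoc by simp
      also have "\<dots> = ((z - z') / (y - y')) *s va"
        unfolding *[symmetric] vector_smult_assoc by simp
      finally show False using transversal by blast
    qed
    then have "(z - z') *s va = 0"
      unfolding * by simp
    then have "z = z'"
      unfolding vector_mul_eq_0 using va(1) by simp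
    show "s = s' \<and> t = t'"
      using z inja injb U' \<open>y = y'\<close> \<open>z = z'\<close> by metis
  qed
  have G0: "G (0, 0) = 0" by (simp add: G_def a0 b0)
  have "open (?U \<times> ?U)" by (simp add: open_Times)
  then obtain r where r: "r > 0"
    and persist: "\<And>F. \<lbrakk>continuous_on (?U \<times> ?U) F; \<And>x. x \<in> ?U \<times> ?U \<Longrightarrow> dist (F x) (G x) \<le> r\<rbrakk>
      \<Longrightarrow> \<exists>x\<in>?U \<times> ?U. F x = 0"
    by (rule zero_of_injective_map_persists[OF _ contG injG, of "(0, 0)"]) (auto simp: G0)
  obtain N where N: "\<And>x. x \<in> cball 0 1 \<Longrightarrow> norm (F (k N) x - g x) < r / 2"
    using unif[of "r / 2"] r by auto
  have close: "norm (A' (k N) x - a x) < r / 2" "norm (B' (k N) x - b x) < r / 2" if "x \<in> ?U" for x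
  proof -
    have "F (k N) x - g x = (A' (k N) x - a x, B' (k N) x - b x)"
      by (simp add: F_def a_def b_def prod_eq_iff)
    then show "norm (A' (k N) x - a x) < r / 2" "norm (B' (k N) x - b x) < r / 2"
      using N[OF U[OF that]] norm_fst_le norm_snd_le by (metis le_less_trans)+
  qed
  have contA': "continuous_on S (A' n)" "continuous_on S (B' n)" for S n
    using up'(1)[of n] up'(2)[of n] \<open>K \<ge> 0\<close>
    by (auto intro!: lipschitz_on_continuous_on lipschitz_onI)
  have "\<exists>x\<in>?U \<times> ?U. (\<lambda>(s, t). A' (k N) s - B' (k N) t) x = 0"
  proof (rule persist)
    show "continuous_on (?U \<times> ?U) (\<lambda>(s, t). A' (k N) s - B' (k N) t)"
      unfolding case_prod_unfold
      by (intro continuous_intros continuous_on_compose2[OF contA'(1)[of UNIV]]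
          continuous_on_compose2[OF contA'(2)[of UNIV]]) auto
    fix x assume "x \<in> ?U \<times> ?U"
    then obtain s t where x: "x = (s, t)" "s \<in> ?U" "t \<in> ?U" by blast
    have "norm ((A' (k N) s - a s) - (B' (k N) t - b t)) \<le> r"
      using close(1)[OF x(2)] close(2)[OF x(3)] norm_triangle_ineq4[of "A' (k N) s - a s" "B' (k N) t - b t"]
      by simp
    then show "dist ((\<lambda>(s, t). A' (k N) s - B' (k N) t) x) (G x) \<le> r"
      by (simp add: x(1) G_def dist_norm algebra_simps)
  qed
  then obtain s t where "A' (k N) s = B' (k N) t" by auto
  then have "A (real (Suc (k N)) *\<^sub>R s) = B (real (Suc (k N)) *\<^sub>R t)"
    by (simp add: A'_def B'_def del: of_nat_Suc)
  then show ?thesis by blast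
qed

section \<open>The chain is not equivalent to a plane curve\<close>

text \<open>The two skew lines of the chain are parametrized isometrically by \<open>\<alpha>\<close> and \<open>\<beta>\<close>. Their distance at \<open>\<alpha> s\<close> and
  \<open>\<beta> t\<close> is at least \<open>norm t\<close>, so their images would have to meet, against injectivity. Stating this for arbitrary
  subsets \<open>D\<close> of a zero set covers images under linear projections, which are given by no equations.\<close>
lemma chain_not_equivalent_in_plane_curve:
  fixes i j k :: "'n::finite" and D :: "(complex ^ 2) set"
  assumes ne: "i \<noteq> j" "i \<noteq> k" "j \<noteq> k"
    and p: "complex_polynomial_function p" "p x0 \<noteq> 0" and D: "\<And>x. x \<in> D \<Longrightarrow> p x = 0"
  shows "\<not> outer_lipschitz_equivalent (three_line_chain i j k) D"
proof
  let ?C = "three_line_chain i j k"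
  assume "outer_lipschitz_equivalent ?C D"
  then obtain f g K L where fg: "homeomorphism ?C D f g" and K: "K-lipschitz_on ?C f"
    and L: "L-lipschitz_on D g"
    unfolding outer_lipschitz_equivalent_def by blast
  have fD: "f x \<in> D" and gf: "g (f x) = x" if "x \<in> ?C" for x
    using fg that unfolding homeomorphism_def by blast+
  have low: "dist x y \<le> L * dist (f x) (f y)" if "x \<in> ?C" "y \<in> ?C" for x y
    using lipschitz_onD[OF L fD[OF that(1)] fD[OF that(2)]] gf that by simp
  define \<alpha> where "\<alpha> s = s *s axis i 1" for s :: complex
  define \<beta> where "\<beta> t = axis k 1 + t *s axis j 1" for t :: complex
  have C: "\<alpha> s \<in> ?C" "\<beta> s \<in> ?C" for s
    by (auto simp: three_line_chain_def coordinate_line_def \<alpha>_def \<beta>_def axis_def)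
  have "dist (\<alpha> s) (\<alpha> t) = dist s t" for s t
    using dist_coordinate_line[of "\<alpha> s" i 0 "\<alpha> t"]
    by (simp add: coordinate_line_def \<alpha>_def axis_def dist_norm)
  moreover have "dist (\<beta> s) (\<beta> t) = dist s t" for s t
    using dist_coordinate_line[of "\<beta> s" j "axis k 1" "\<beta> t"] ne
    by (simp add: coordinate_line_def \<beta>_def axis_def dist_norm)
  moreover have "norm t \<le> L * dist (f (\<alpha> s)) (f (\<beta> t))" for s t
  proof -
    have "norm t \<le> dist (\<alpha> s) (\<beta> t)"
      using Finite_Cartesian_Product.norm_nth_le[of "\<alpha> s - \<beta> t" j] ne
      by (simp add: \<alpha>_def \<beta>_def axis_def dist_norm)
    then show ?thesis using low[OF C(1) C(2)] by (rule order_trans)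
  qed
  ultimately have "\<exists>s t. f (\<alpha> s) = f (\<beta> t)"
    using lipschitz_onD[OF K C(1) C(1)] lipschitz_onD[OF K C(2) C(2)]
      low[OF C(1) C(1)] low[OF C(2) C(2)] D[OF fD[OF C(1)]] D[OF fD[OF C(2)]]
    by (intro asymptotic_planes_meet[OF p, where K = K and L = L]) auto
  then obtain s t where "\<alpha> s = \<beta> t"
    using gf C by metis
  then have "\<alpha> s $ k = \<beta> t $ k" by simp
  then show False using ne by (simp add: \<alpha>_def \<beta>_def axis_def)
qed

text \<open>The part of the first line off \<open>0\<close> is open in the chain and has real dimension 2, so it would be an open
  subset of a space of real dimension 4.\<close>
lemma chain_not_homeomorphic_plane:
  fixes i j k :: "'n::finite"
  assumes ne: "i \<noteq> j" "i \<noteq> k"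
  shows "\<not> homeomorphism (three_line_chain i j k) (UNIV :: (complex ^ 2) set) f g"
proof
  assume fg: "homeomorphism (three_line_chain i j k) (UNIV :: (complex ^ 2) set) f g"
  then have contg: "continuous_on UNIV g" and gC: "\<And>y. g y \<in> three_line_chain i j k"
    and gf: "\<And>x. x \<in> three_line_chain i j k \<Longrightarrow> g (f x) = x" and fg': "\<And>y. f (g y) = y"
    unfolding homeomorphism_def by auto
  have contgi: "continuous_on UNIV (\<lambda>y. g y $ i)" by (intro continuous_intros contg)
  define V where "V = {y. g y $ i \<noteq> 0}"
  have "open V"
    unfolding V_def using open_Collect_neq[OF contgi continuous_on_const] .
  moreover have "continuous_on V (\<lambda>y. g y $ i)"
    using contgi by (rule continuous_on_subset) simp
  moreover have "inj_on (\<lambda>y. g y $ i) V"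
  proof (rule inj_onI)
    have on_line: "g y = g y $ i *s axis i 1" if "y \<in> V" for y
      using that gC[of y] ne
      by (auto simp: V_def three_line_chain_def coordinate_line_def axis_def vec_eq_iff)
    fix y y' assume y: "y \<in> V" "y' \<in> V" and eq: "g y $ i = g y' $ i"
    have "g y = g y $ i *s axis i 1" by (rule on_line[OF y(1)])
    also have "\<dots> = g y'" unfolding eq by (rule on_line[OF y(2), symmetric])
    finally have "f (g y) = f (g y')" by (rule arg_cong)
    then show "y = y'" unfolding fg' .
  qed
  moreover have "f (axis i 1) \<in> V"
    using gf[of "axis i 1"] by (simp add: V_def three_line_chain_def coordinate_line_def axis_def)
  then have "V \<noteq> {}" by blast
  ultimately have "DIM(complex ^ 2) \<le> DIM(complex)"
    using invariance_of_dimension by blast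
  then show False by simp
qed

lemma chain_not_equivalent_to_algebraic_set:
  fixes i j k :: "'n::finite" and D :: "(complex ^ 2) set"
  assumes ne: "i \<noteq> j" "i \<noteq> k" "j \<noteq> k" and "algebraic_set D"
  shows "\<not> outer_lipschitz_equivalent (three_line_chain i j k) D"
proof (cases "D = UNIV")
  case True
  then show ?thesis
    using chain_not_homeomorphic_plane[OF ne(1,2)] unfolding outer_lipschitz_equivalent_def by blast
next
  case False
  obtain F where F: "\<forall>f\<in>F. complex_polynomial_function f" "D = {x. \<forall>f\<in>F. f x = 0}"
    using assms(4) unfolding algebraic_set_def by blast
  with False obtain f x0 where "f \<in> F" "f x0 \<noteq> 0" by blast
  with F show ?thesis
    by (intro chain_not_equivalent_in_plane_curve[OF ne, of f x0]) auto
qed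

text \<open>On the line through a nonzero of \<open>p\<close> and a nonzero of \<open>q\<close>, both restrict to nonzero polynomials in one
  variable.\<close>
lemma nonzero_polynomials_mult:
  fixes p q :: "complex ^ 'n \<Rightarrow> complex"
  assumes p: "complex_polynomial_function p" "p x \<noteq> 0" and q: "complex_polynomial_function q" "q y \<noteq> 0"
  shows "\<exists>z. p z * q z \<noteq> 0"
proof -
  obtain p' where p': "\<And>t. p (x + t *s (y - x)) = poly p' t"
    using polynomial_on_line[OF p(1)] by metis
  obtain q' where q': "\<And>t. q (x + t *s (y - x)) = poly q' t"
    using polynomial_on_line[OF q(1)] by metis
  have "p' \<noteq> 0" "q' \<noteq> 0" using p'[of 0] q'[of 1] p(2) q(2) by auto
  then have "p' * q' \<noteq> 0" by simp
  then obtain t where "poly (p' * q') t \<noteq> 0" using poly_all_0_iff_0 by blast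
  then show ?thesis using p'[of t] q'[of t] by (metis poly_mult)
qed

lemma affine_line_in_plane_curve:
  fixes a v :: "complex ^ 2"
  obtains p x where "complex_polynomial_function p" "p x \<noteq> 0" "\<And>t. p (a + t *s v) = 0"
proof -
  define p where "p n x = n $ 1 * x $ 1 + n $ 2 * x $ 2 + - (n $ 1 * a $ 1 + n $ 2 * a $ 2)" for n x :: "complex ^ 2"
  have poly: "complex_polynomial_function (p n)" for n
    unfolding p_def by (intro complex_polynomial_function.intros)
  obtain n :: "complex ^ 2" and m where n: "n $ 1 * v $ 1 + n $ 2 * v $ 2 = 0" "n $ m \<noteq> 0"
  proof (cases "v = 0")
    case True
    then show ?thesis using that[of "axis 1 1" 1] by (simp add: axis_def)
  next
    case False
    then have "v $ 1 \<noteq> 0 \<or> v $ 2 \<noteq> 0" by (simp add: vec_eq_iff forall_2)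
    then show ?thesis
      using that[of "vector [v $ 2, - v $ 1]" 1] that[of "vector [v $ 2, - v $ 1]" 2] by auto
  qed
  have "p n (a + axis m 1) = n $ m"
    using exhaust_2[of m] by (auto simp: p_def axis_def algebra_simps)
  moreover have "p n (a + t *s v) = t * (n $ 1 * v $ 1 + n $ 2 * v $ 2)" for t
    by (simp add: p_def algebra_simps)
  ultimately show ?thesis
    using that[OF poly, of n "a + axis m 1"] n by simp
qed

text \<open>Each line of the chain projects into an affine line of the plane, or to a point, so the product of three
  affine functions vanishes on the whole projection.\<close>
lemma chain_not_equivalent_to_projection:
  fixes i j k :: "'n::finite" and P :: "complex ^ 'n \<Rightarrow> complex ^ 2"
  assumes ne: "i \<noteq> j" "i \<noteq> k" "j \<noteq> k" and P: "Vector_Spaces.linear (*s) (*s) P"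
  shows "\<not> outer_lipschitz_equivalent (three_line_chain i j k) (P ` three_line_chain i j k)"
proof -
  interpret Vector_Spaces.linear "(*s)" "(*s)" P by (rule P)
  have *: "\<exists>p x. complex_polynomial_function p \<and> p x \<noteq> 0 \<and> (\<forall>y\<in>coordinate_line m a. p (P y) = 0)" for m a
  proof -
    obtain p x where p: "complex_polynomial_function p" "p x \<noteq> 0" "\<And>t. p (P a + t *s P (axis m 1)) = 0"
      using affine_line_in_plane_curve by metis
    then show ?thesis
      unfolding coordinate_line_eq by (intro exI[of _ p] exI[of _ x]) (auto simp: add scale)
  qed
  obtain p x where p: "complex_polynomial_function p" "p x \<noteq> 0" "\<forall>y\<in>coordinate_line i 0. p (P y) = 0"
    using * by blast
  obtain q y where q: "complex_polynomial_function q" "q y \<noteq> 0" "\<forall>y\<in>coordinate_line k 0. q (P y) = 0"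
    using * by blast
  obtain r z where r: "complex_polynomial_function r" "r z \<noteq> 0" "\<forall>y\<in>coordinate_line j (axis k 1). r (P y) = 0"
    using * by blast
  have pq: "complex_polynomial_function (\<lambda>x. p x * q x)"
    by (rule complex_polynomial_function.mult[OF p(1) q(1)])
  have pqr: "complex_polynomial_function (\<lambda>x. p x * q x * r x)"
    by (rule complex_polynomial_function.mult[OF pq r(1)])
  obtain u where "p u * q u \<noteq> 0" using nonzero_polynomials_mult[OF p(1,2) q(1,2)] by blast
  then obtain w where "p w * q w * r w \<noteq> 0" using nonzero_polynomials_mult[OF pq _ r(1,2)] by blast
  then show ?thesis
    by (rule chain_not_equivalent_in_plane_curve[OF ne pqr])
      (use p(3) q(3) r(3) in \<open>auto simp: three_line_chain_def\<close>)
qed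

theorem corollary10p5:
  assumes "CARD('n::finite) \<ge> 3"
  shows "(\<exists>C :: (complex ^ 'n) set.
            algebraic_curve C \<and> lipschitz_normally_embedded C \<and>
            (\<forall>D :: (complex ^ 2) set. algebraic_curve D \<longrightarrow> \<not> outer_lipschitz_equivalent C D)) \<and>
         (\<exists>C :: (complex ^ 'n) set.
            algebraic_curve C \<and> lipschitz_normally_embedded C \<and>
            (\<forall>P :: complex ^ 'n \<Rightarrow> complex ^ 2.
               Vector_Spaces.linear (*s) (*s) P \<and> surj P \<longrightarrow>
               \<not> outer_lipschitz_equivalent C (P ` C)))"
proof -
  obtain S :: "'n set" where "card S = 3"
    using assms obtain_subset_with_card_n by metis
  then obtain i j k :: 'n where ne: "i \<noteq> j" "i \<noteq> k" "j \<noteq> k"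
    by (auto simp: card_3_iff)
  show ?thesis
    using algebraic_curve_three_line_chain[of i j k]
      lipschitz_normally_embedded_three_line_chain[OF ne]
      chain_not_equivalent_to_algebraic_set[OF ne] chain_not_equivalent_to_projection[OF ne]
    unfolding algebraic_curve_def by blast
qed

end
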